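(* Let $G$ be a connected simple graph on at least two vertices that has a perfect matching or a nearly perfect matching. Then there exist an edge weighting $w$ of $G$ and a vertex $v$ of $G$ such that $G$ is $\mathrm{SRSI}_w(v)$.
   Context: A matching in a graph is a set of pairwise disjoint edges; a $k$-matching is a matching of size $k$. A matching is perfect if it saturates (covers) all vertices, and nearly perfect if it saturates all but exactly one vertex. An edge weighting (weight function) of a simple graph $G=(V,E)$ is a function $w:E\to\mathbb{R}^+$ to the positive reals. For a weighted graph on $n$ vertices, the weighted matching polynomial is $$m_w(G,x)=\sum_{k=0}^{\lfloor n/2\rfloor}(-1)^k\mu_w(G,k)\,x^{n-2k},\qquad \mu_w(G,k)=\sum_{M\text{ a }k\text{-matching of }G}\ \prod_{e\in M}w(e),$$ with $\mu_w(G,0)=1$. On subgraphs, $w$ is understood to be restricted. $G\setminus\{v\}$ denotes the graph obtained by deleting the vertex $v$. All roots of $m_w(G,x)$ are real. A weighted graph $G=(V,E,w)$ on $n\ge 2$ vertices is $\mathrm{SRSI}_w(v)$, where $v\in V$, if: (1) $m_w(G,x)$ has simple roots $\lambda_1<\dots<\lambda_n$; and (2) $m_w(G\setminus\{v\},x)$ has simple roots $\mu_1<\dots<\mu_{n-1}$ that strictly interlace those of $m_w(G,x)$, i.e. $\lambda_1<\mu_1<\lambda_2<\dots<\mu_{n-1}<\lambda_n$. *)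

theory Defs
  imports Complex_Main "HOL-Computational_Algebra.Polynomial"
begin

(* A graph is given by its vertex set V and its set E of edges, each edge being
   the two-element set of its endpoints. *)

definition simple_graph :: "'a set \<Rightarrow> 'a set set \<Rightarrow> bool" where
  "simple_graph V E \<longleftrightarrow> finite V \<and> (\<forall>e\<in>E. e \<subseteq> V \<and> card e = 2)"

definition connected_graph :: "'a set \<Rightarrow> 'a set set \<Rightarrow> bool" where
  "connected_graph V E \<longleftrightarrow> V \<noteq> {} \<and> (\<forall>u\<in>V. \<forall>v\<in>V. (u, v) \<in> {(x, y). {x, y} \<in> E}\<^sup>*)"

definition is_matching :: "'a set set \<Rightarrow> 'a set set \<Rightarrow> bool" where
  "is_matching E M \<longleftrightarrow> M \<subseteq> E \<and> pairwise disjnt M"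

definition perfect_matching :: "'a set \<Rightarrow> 'a set set \<Rightarrow> 'a set set \<Rightarrow> bool" where
  "perfect_matching V E M \<longleftrightarrow> is_matching E M \<and> \<Union>M = V"

definition nearly_perfect_matching :: "'a set \<Rightarrow> 'a set set \<Rightarrow> 'a set set \<Rightarrow> bool" where
  "nearly_perfect_matching V E M \<longleftrightarrow> is_matching E M \<and> (\<exists>u\<in>V. \<Union>M = V - {u})"

(* A weight function is total on sets of vertices, but only its values on edges
   are ever used; so its restriction to a subgraph is the same function. *)

definition edge_weighting :: "'a set set \<Rightarrow> ('a set \<Rightarrow> real) \<Rightarrow> bool" where
  "edge_weighting E w \<longleftrightarrow> (\<forall>e\<in>E. w e > 0)"

definition matching_weight :: "'a set set \<Rightarrow> ('a set \<Rightarrow> real) \<Rightarrow> nat \<Rightarrow> real" where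
  "matching_weight E w k = (\<Sum>M \<in> {M. is_matching E M \<and> card M = k}. \<Prod>e\<in>M. w e)"

definition matching_poly :: "'a set \<Rightarrow> 'a set set \<Rightarrow> ('a set \<Rightarrow> real) \<Rightarrow> real poly" where
  "matching_poly V E w =
     (\<Sum>k = 0..card V div 2. monom ((-1) ^ k * matching_weight E w k) (card V - 2 * k))"

definition del_vertex_edges :: "'a set set \<Rightarrow> 'a \<Rightarrow> 'a set set" where
  "del_vertex_edges E v = {e \<in> E. v \<notin> e}"

(* The real roots of p are l 1 < ... < l n, each of multiplicity one. Below, p is
   always a matching polynomial of a graph on n vertices, which has degree n, so
   these are all of its complex roots too. *)

definition simple_roots :: "real poly \<Rightarrow> nat \<Rightarrow> (nat \<Rightarrow> real) \<Rightarrow> bool" where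
  "simple_roots p n l \<longleftrightarrow>
     strict_mono_on {1..n} l \<and> l ` {1..n} = {x. poly p x = 0} \<and> (\<forall>i\<in>{1..n}. order (l i) p = 1)"

definition SRSI :: "'a set \<Rightarrow> 'a set set \<Rightarrow> ('a set \<Rightarrow> real) \<Rightarrow> 'a \<Rightarrow> bool" where
  "SRSI V E w v \<longleftrightarrow> card V \<ge> 2 \<and> v \<in> V \<and>
     (\<exists>l m. simple_roots (matching_poly V E w) (card V) l \<and>
            simple_roots (matching_poly (V - {v}) (del_vertex_edges E v) w) (card V - 1) m \<and>
            (\<forall>i\<in>{1..card V - 1}. l i < m i \<and> m i < l (i + 1)))"

end

(* Let v be an arbitrary vertex if the matching is perfect and the unsaturated vertex otherwise, and
   let u be a neighbour of v, namely its partner if v is matched. Let H be the component of u in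
   G - v and K = G - H. Then
     m(G) = m(H) m(K) - m(K - v) * (sum over x in H adjacent to v of w(xv) m(H - x)),
     m(G - v) = m(H) m(K - v).
   By induction H and K have weightings with strict interlacing at u and at v. Multiplying all weights
   on H by s^2 multiplies the roots of m(H) by s, so m(H) and m(K - v) can be made to have no common
   root: 0 is not a root of m(K - v), since K - v is perfectly matched, hence has even order, and an
   even polynomial has no simple root at 0. With weight 1 on uv and a small weight on the other edges
   from v to H, the sign of m(G) at each root of m(G - v) is the one that strict interlacing needs. *)

theory Submission
  imports Defs
begin

section \<open>Strictly interlacing real-rooted polynomials\<close>

lemma sgn_prod_diff:
  fixes x :: real
  assumes "finite A" "\<And>j. j \<in> A \<Longrightarrow> y j \<noteq> x"
  shows "sgn (\<Prod>j\<in>A. x - y j) = (-1) ^ card {j\<in>A. x < y j}"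
  using assms
proof (induction A rule: finite_induct)
  case (insert a A)
  have eq: "{j \<in> insert a A. x < y j} = (if x < y a then insert a {j\<in>A. x < y j} else {j\<in>A. x < y j})"
    by auto
  have "y a \<noteq> x" using insert.prems by auto
  then have "sgn (x - y a) = (if x < y a then -1 else 1)" by auto
  then show ?case using insert unfolding eq
    by (auto simp: sgn_mult)
qed simp

text \<open>Both sides have the same degree and leading coefficient, so their difference would have
  more zeros than its degree allows.\<close>

lemma poly_eq_prod_roots:
  fixes p :: "'a::idom poly"
  assumes "lead_coeff p = 1" "finite I" "inj_on l I" "card I = degree p"
    and "\<And>i. i \<in> I \<Longrightarrow> poly p (l i) = 0"
  shows "p = (\<Prod>i\<in>I. [:- l i, 1:])"
proof (rule poly_eqI_degree_lead_coeff[where n = "degree p" and A = "l ` I"])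
  have d: "degree (\<Prod>i\<in>I. [:- l i, 1:]) = degree p"
    by (subst degree_prod_sum_eq) (auto simp: assms)
  have "lead_coeff (\<Prod>i\<in>I. [:- l i, 1:]) = 1"
    by (simp add: lead_coeff_prod)
  then show "coeff p (degree p) = coeff (\<Prod>i\<in>I. [:- l i, 1:]) (degree p)"
    using assms d by simp
  show "card (l ` I) \<ge> degree p" using assms by (simp add: card_image)
  show "degree (\<Prod>i\<in>I. [:- l i, 1:]) \<le> degree p" using d by simp
  show "poly p z = poly (\<Prod>i\<in>I. [:- l i, 1:]) z" if "z \<in> l ` I" for z
    using that assms(2,5) by (auto simp: poly_prod prod_zero_iff intro!: bexI)
qed simp

lemma poly_pderiv_prod_root:
  fixes l :: "'i \<Rightarrow> 'a::idom"
  assumes "finite I" "i \<in> I"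
  shows "poly (pderiv (\<Prod>j\<in>I. [:- l j, 1:])) (l i) = (\<Prod>j\<in>I - {i}. l i - l j)"
proof -
  have "(\<Prod>j\<in>I. [:- l j, 1:]) = [:- l i, 1:] * (\<Prod>j\<in>I - {i}. [:- l j, 1:])"
    using assms by (simp add: prod.remove)
  then show ?thesis
    by (simp add: pderiv_mult pderiv_pCons poly_prod del: mult_pCons_left)
qed

lemma finite_set_strict_mono_enum:
  fixes A :: "'a::linorder set"
  assumes "finite A"
  obtains f where "strict_mono_on {1..card A} f" "f ` {1..card A} = A"
proof
  let ?xs = "sorted_list_of_set A"
  let ?f = "\<lambda>i. ?xs ! (i - 1)"
  show "strict_mono_on {1..card A} ?f"
    by (rule strict_mono_onI) (auto intro!: sorted_wrt_nth_less[OF strict_sorted_list_of_set])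
  have "?f ` {1..card A} = (!) ?xs ` {..<card A}"
    by (force simp: image_iff Bex_def intro: exI[of _ "Suc _"])
  also have "\<dots> = A"
    using assms by (metis atLeast_upt length_sorted_list_of_set list.set_map map_nth set_sorted_list_of_set)
  finally show "?f ` {1..card A} = A" .
qed

text \<open>Reflecting \<open>x\<close> to \<open>-x\<close> reduces this to the behaviour at plus
  infinity; the power of -1 keeps the reflected leading coefficient positive.\<close>

lemma poly_minus_infinity_sgn:
  fixes p :: "real poly"
  assumes "lead_coeff p > 0"
  shows "\<exists>n. \<forall>x\<le>n. (-1) ^ degree p * poly p x > 0"
proof -
  let ?q = "smult ((-1) ^ degree p) (pcompose p [:0, -1:])"
  have "lead_coeff ?q = lead_coeff p"
    by (subst lead_coeff_smult, subst lead_coeff_comp) (auto simp flip: power_mult_distrib)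
  then obtain n where n: "\<And>x. x \<ge> n \<Longrightarrow> poly ?q x \<ge> lead_coeff p"
    using poly_pinfty_gt_lc[of ?q] assms by auto
  have "(-1) ^ degree p * poly p x > 0" if "x \<le> - n" for x
    using n[of "- x"] that assms by (simp add: poly_pcompose)
  then show ?thesis by blast
qed

text \<open>This counts the negative factors in the derivative of a product with roots
  \<open>m\<close>, taken at its \<open>i\<close>-th root.\<close>

lemma strict_mono_on_card_greater:
  fixes m :: "nat \<Rightarrow> 'a::linorder"
  assumes "strict_mono_on {1..n} m" "i \<in> {1..n}"
  shows "card {j \<in> {1..n} - {i}. m i < m j} = n - i"
proof -
  have "{j \<in> {1..n} - {i}. m i < m j} = {i<..n}"
    using assms by (auto simp: strict_mono_on_less)
  then show ?thesis by simp
qed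

section \<open>Interlacing: from signs to ordered roots and back\<close>

definition strictly_interlacing :: "nat \<Rightarrow> (nat \<Rightarrow> real) \<Rightarrow> (nat \<Rightarrow> real) \<Rightarrow> bool" where
  "strictly_interlacing n l m \<longleftrightarrow> strict_mono_on {1..Suc n} l \<and> strict_mono_on {1..n} m \<and>
    (\<forall>i\<in>{1..n}. l i < m i \<and> m i < l (i + 1))"

text \<open>For monic \<open>p\<close> and \<open>q\<close> with \<open>degree p = degree q + 1\<close>, this sign condition is equivalent to
  strict interlacing of simple real roots. Unlike the latter, it is checked one root at a time, so it
  passes to products and sums without any sorting of roots.\<close>

definition interlaces :: "real poly \<Rightarrow> real poly \<Rightarrow> bool" where
  "interlaces q p \<longleftrightarrow> card {x. poly q x = 0} = degree q \<and>
    (\<forall>x. poly q x = 0 \<longrightarrow> poly p x * poly (pderiv q) x < 0)"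

text \<open>The derivative of \<open>q\<close> alternates in sign along the roots of
  \<open>q\<close>, hence so does \<open>p\<close>. With the signs of \<open>p\<close> at both
  infinities this gives \<open>n + 1\<close> sign changes, so a root of \<open>p\<close> in every
  gap, and the degree leaves room for no others.\<close>

lemma interlaces_roots:
  assumes p: "lead_coeff p = 1" and q: "lead_coeff q = 1" and deg: "degree p = Suc n" "degree q = n"
    and "interlaces q p"
  obtains l m where "strictly_interlacing n l m"
    "p = (\<Prod>i\<in>{1..Suc n}. [:- l i, 1:])" "q = (\<Prod>i\<in>{1..n}. [:- m i, 1:])"
proof -
  have card: "card {x. poly q x = 0} = n"
    and neg: "\<And>x. poly q x = 0 \<Longrightarrow> poly p x * poly (pderiv q) x < 0"
    using assms by (auto simp: interlaces_def)
  have "q \<noteq> 0" using q by auto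
  have "finite {x. poly q x = 0}" using \<open>q \<noteq> 0\<close> by (rule poly_roots_finite)
  then obtain m where m: "strict_mono_on {1..n} m" and mq: "m ` {1..n} = {x. poly q x = 0}"
    using finite_set_strict_mono_enum card by metis
  have minj: "inj_on m {1..n}" using m by (rule strict_mono_on_imp_inj_on)
  have qeq: "q = (\<Prod>i\<in>{1..n}. [:- m i, 1:])"
    using mq minj q deg by (intro poly_eq_prod_roots) auto
  have sgnm: "sgn (poly p (m i)) = (-1) ^ (Suc n - i)" if i: "i \<in> {1..n}" for i
  proof -
    have "sgn (poly (pderiv q) (m i)) = (-1) ^ card {j \<in> {1..n} - {i}. m i < m j}"
      using i minj unfolding qeq
      by (subst poly_pderiv_prod_root, simp, simp, subst sgn_prod_diff) (auto dest: inj_onD)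
    also have "\<dots> = (-1) ^ (n - i)"
      using strict_mono_on_card_greater[OF m i] by simp
    finally have d: "sgn (poly (pderiv q) (m i)) = (-1) ^ (n - i)" .
    have "poly q (m i) = 0" using mq i by auto
    from neg[OF this] have "sgn (poly p (m i)) * sgn (poly (pderiv q) (m i)) = -1"
      by (simp flip: sgn_mult)
    \<comment> \<open>The power \<open>(-1) ^ (n - i)\<close> is its own inverse, so multiplying by
      it isolates the sign of \<open>p\<close>.\<close>
    then have "sgn (poly p (m i)) * ((-1) ^ (n - i) * (-1) ^ (n - i)) = - ((-1) ^ (n - i))"
      unfolding d by (metis mult.assoc mult_minus1)
    then show ?thesis using i by (simp add: Suc_diff_le flip: power_mult_distrib)
  qed
  obtain a where a: "\<And>x. x \<le> a \<Longrightarrow> (-1) ^ Suc n * poly p x > 0"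
    using poly_minus_infinity_sgn[of p] p deg by auto
  obtain b where b: "\<And>x. x \<ge> b \<Longrightarrow> poly p x \<ge> 1"
    using poly_pinfty_gt_lc[of p] p by auto
  \<comment> \<open>The window from \<open>lo\<close> to \<open>hi\<close> contains all roots of
    \<open>q\<close> and reaches far enough for \<open>p\<close> to have its asymptotic signs at
    both ends.\<close>
  define S where "S = insert a (insert b (m ` {1..n}))"
  define lo where "lo = Min S - 1"
  define hi where "hi = Max S + 1"
  have bounds: "lo < x \<and> x < hi" if "x \<in> S" for x
    using that Min_le[of S x] Max_ge[of S x] by (auto simp: lo_def hi_def S_def)
  have lo: "lo \<le> a" "\<And>i. i \<in> {1..n} \<Longrightarrow> lo < m i"
    and hi: "b \<le> hi" "lo < hi" "\<And>i. i \<in> {1..n} \<Longrightarrow> m i < hi"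
    using bounds[of a] bounds[of b] bounds[of "m _"] unfolding S_def by fastforce+
  \<comment> \<open>Indices 0 and \<open>Suc n\<close> act as sentinels: the \<open>i\<close>-th gap
    runs from \<open>c (i - 1)\<close> to \<open>c i\<close>, the two outer gaps included.\<close>
  define c where "c i = (if i = 0 then lo else if i = Suc n then hi else m i)" for i
  have sgnc: "sgn (poly p (c i)) = (-1) ^ (Suc n - i)" if le: "i \<le> Suc n" for i
  proof -
    consider "i = 0" | "i \<in> {1..n}" | "i = Suc n"
      using le by (cases "i = 0"; cases "i = Suc n") auto
    then show ?thesis
    proof cases
      case 1
      then show ?thesis using a[of lo] lo
        by (cases "even n") (auto simp: c_def)
    next
      case 3
      then show ?thesis using b[of hi] hi by (auto simp: c_def)
    qed (use sgnm in \<open>auto simp: c_def\<close>)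
  qed
  have cless: "c i < c (Suc i)" if "i \<le> n" for i
    using that lo hi m by (auto simp: c_def strict_mono_on_def)
  have "\<exists>x. c (i - 1) < x \<and> x < c i \<and> poly p x = 0" if i: "i \<in> {1..Suc n}" for i
  proof -
    have "sgn (poly p (c (i - 1))) = - ((-1) ^ (Suc n - i))"
    proof -
      have "i - 1 \<le> Suc n" using i by auto
      from sgnc[OF this] show ?thesis using i by (simp add: Suc_diff_le)
    qed
    moreover have "sgn (poly p (c i)) = (-1) ^ (Suc n - i)" using i sgnc[of i] by simp
    ultimately have "sgn (poly p (c (i - 1))) * sgn (poly p (c i)) = -1"
      by (simp flip: power_mult_distrib)
    then have "poly p (c (i - 1)) * poly p (c i) < 0"
      by (metis sgn_mult sgn_less neg_less_0_iff_less zero_less_one)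
    then show ?thesis using poly_IVT[of "c (i - 1)" "c i" p] cless[of "i - 1"] i by auto
  qed
  then obtain l where l: "\<And>i. i \<in> {1..Suc n} \<Longrightarrow> c (i - 1) < l i \<and> l i < c i \<and> poly p (l i) = 0"
    by metis
  have inter: "l i < m i \<and> m i < l (i + 1)" if "i \<in> {1..n}" for i
    using l[of i] l[of "i + 1"] that by (auto simp: c_def)
  have lmono: "strict_mono_on {1..Suc n} l"
  proof (rule strict_mono_onI)
    fix r s assume rs: "r \<in> {1..Suc n}" "s \<in> {1..Suc n}" "r < s"
    have "s - 1 \<in> {1..n}" using rs by auto
    have "l r < m r" using inter rs by auto
    also have "m r \<le> m (s - 1)" using rs by (intro strict_mono_on_leD[OF m]) auto
    also have "m (s - 1) < l s" using inter[OF \<open>s - 1 \<in> {1..n}\<close>] rs by simp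
    finally show "l r < l s" .
  qed
  have "p = (\<Prod>i\<in>{1..Suc n}. [:- l i, 1:])"
    using l p deg strict_mono_on_imp_inj_on[OF lmono] by (intro poly_eq_prod_roots) auto
  then show thesis using that[of l m] inter lmono m qeq by (auto simp: strictly_interlacing_def)
qed

text \<open>Exactly \<open>n + 1 - i\<close> roots of \<open>q\<close>, and as many of
  \<open>p\<close>, lie above the \<open>i\<close>-th root of \<open>p\<close>, so \<open>q\<close>
  and the derivative of \<open>p\<close> have equal signs there. This moves the sign condition from
  the roots of \<open>q\<close> to those of \<open>p\<close>, where the branch \<open>H\<close>
  needs it.\<close>

lemma interlaces_dual:
  assumes p: "lead_coeff p = 1" and q: "lead_coeff q = 1" and deg: "degree p = Suc n" "degree q = n"
    and int: "interlaces q p"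
  shows "card {x. poly p x = 0} = Suc n"
    and "poly p x = 0 \<Longrightarrow> poly q x * poly (pderiv p) x > 0"
proof -
  obtain l m where lm: "strictly_interlacing n l m"
    and peq: "p = (\<Prod>i\<in>{1..Suc n}. [:- l i, 1:])" and qeq: "q = (\<Prod>i\<in>{1..n}. [:- m i, 1:])"
    using interlaces_roots[OF p q deg int] by metis
  have l: "strict_mono_on {1..Suc n} l" and m: "strict_mono_on {1..n} m"
    using lm by (auto simp: strictly_interlacing_def)
  have linj: "inj_on l {1..Suc n}" using l by (rule strict_mono_on_imp_inj_on)
  have roots: "{x. poly p x = 0} = l ` {1..Suc n}"
    unfolding peq poly_prod by (auto simp: prod_zero_iff simp del: prod.cl_ivl_Suc)
  then show "card {x. poly p x = 0} = Suc n"
    using linj by (simp add: card_image)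
  assume "poly p x = 0"
  then have "x \<in> l ` {1..Suc n}" using roots by blast
  then obtain i where i: "i \<in> {1..Suc n}" and x: "x = l i" by blast
  have iff: "l i < m j \<longleftrightarrow> i \<le> j" and ne: "m j \<noteq> l i" if j: "j \<in> {1..n}" for j
  proof -
    have "l j < m j" "m j < l (Suc j)" using lm j by (auto simp: strictly_interlacing_def)
    moreover have "i \<le> j \<Longrightarrow> l i \<le> l j" "\<not> i \<le> j \<Longrightarrow> l (Suc j) \<le> l i"
      using l i j by (auto intro!: strict_mono_on_leD[OF l])
    ultimately show "l i < m j \<longleftrightarrow> i \<le> j" "m j \<noteq> l i" by force+
  qed
  have "sgn (poly q x) = (-1) ^ card {j \<in> {1..n}. l i < m j}"
    unfolding qeq poly_prod x using ne sgn_prod_diff[of "{1..n}" m "l i"] by simp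
  also have "{j \<in> {1..n}. l i < m j} = {i..n}" using iff i by auto
  finally have 1: "sgn (poly q x) = (-1) ^ (Suc n - i)" by simp
  have "sgn (poly (pderiv p) x) = (-1) ^ card {j \<in> {1..Suc n} - {i}. l i < l j}"
    using i linj unfolding peq x
    by (subst poly_pderiv_prod_root, simp, simp, subst sgn_prod_diff) (auto dest: inj_onD)
  then have 2: "sgn (poly (pderiv p) x) = (-1) ^ (Suc n - i)"
    using strict_mono_on_card_greater[OF l i] by simp
  have "sgn (poly q x * poly (pderiv p) x) = 1"
    unfolding sgn_mult 1 2 by (simp flip: power_mult_distrib)
  then show "poly q x * poly (pderiv p) x > 0" by (simp add: sgn_1_pos)
qed

lemma simple_roots_prod:
  assumes "strict_mono_on {1..n} l"
  shows "simple_roots (\<Prod>i\<in>{1..n}. [:- l i, 1:]) n l"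
proof -
  let ?p = "\<Prod>i\<in>{1..n}. [:- l i, 1:]"
  have roots: "l ` {1..n} = {x. poly ?p x = 0}"
    unfolding poly_prod by (auto simp: prod_zero_iff)
  have "order (l i) ?p = 1" if i: "i \<in> {1..n}" for i
  proof -
    have "poly (pderiv ?p) (l i) \<noteq> 0"
      using i strict_mono_on_imp_inj_on[OF assms] by (subst poly_pderiv_prod_root) (auto dest: inj_onD)
    moreover have "poly ?p (l i) = 0" "?p \<noteq> 0" using roots i by auto
    ultimately show ?thesis by (simp add: order_pderiv order_0I)
  qed
  then show ?thesis using assms roots by (auto simp: simple_roots_def)
qed

section \<open>Rescaling and perturbation of root sets\<close>

text \<open>The derivative of \<open>q\<close> at 0 is \<open>coeff q 1\<close>, and the strict sign
  condition forbids a common zero of \<open>q\<close> and its derivative.\<close>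

lemma interlaces_coeff_1_root:
  assumes "interlaces q p" "coeff q 1 = 0"
  shows "poly q 0 \<noteq> 0"
proof
  assume "poly q 0 = 0"
  then have "poly p 0 * poly (pderiv q) 0 < 0" using assms(1) by (simp add: interlaces_def)
  moreover have "poly (pderiv q) 0 = 0"
    using assms(2) by (simp add: poly_0_coeff_0 coeff_pderiv)
  ultimately show False by simp
qed

text \<open>Roots are multiplied by \<open>s\<close>, values and derivatives only by positive
  factors. The factors \<open>a\<close> and \<open>b\<close> are separate because rescaled weights
  produce different powers of \<open>s\<close> in the two polynomials.\<close>

lemma interlaces_scale:
  assumes "interlaces q p" "s > 0" "a > 0" "b > 0"
  shows "interlaces (smult a (pcompose q [:0, 1 / s:])) (smult b (pcompose p [:0, 1 / s:]))"
proof -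
  have card: "card {x. poly q x = 0} = degree q"
    and neg: "\<And>x. poly q x = 0 \<Longrightarrow> poly p x * poly (pderiv q) x < 0"
    using assms(1) by (auto simp: interlaces_def)
  have "{x. poly (smult a (pcompose q [:0, 1 / s:])) x = 0} = (\<lambda>x. s * x) ` {x. poly q x = 0}"
    using assms by (force simp: poly_pcompose image_iff field_simps intro: exI[of _ "_ / s"])
  moreover have "inj_on (\<lambda>x. s * x) {x. poly q x = 0}" using assms by (auto intro: inj_onI)
  ultimately have "card {x. poly (smult a (pcompose q [:0, 1 / s:])) x = 0} = degree q"
    by (simp only: card_image card)
  moreover have "degree (smult a (pcompose q [:0, 1 / s:])) = degree q"
    using assms by (simp add: degree_pcompose)
  moreover have "b * poly p (x / s) * (a * (poly (pderiv q) (x / s) * (1 / s))) < 0"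
    if "poly q (x / s) = 0" for x
  proof -
    have "a * b / s * (poly p (x / s) * poly (pderiv q) (x / s)) < 0"
      by (rule mult_pos_neg) (use neg[OF that] assms in auto)
    then show ?thesis by (simp add: field_simps)
  qed
  ultimately show ?thesis using assms(3)
    by (auto simp: interlaces_def poly_pcompose pderiv_smult pderiv_pcompose pderiv_pCons)
qed

text \<open>Only finitely many ratios carry a root of \<open>p\<close> to a root of
  \<open>q\<close>. A root of \<open>p\<close> at 0 is fixed by every scaling, so \<open>q\<close>
  must not vanish there.\<close>

lemma exists_scaling_disjoint_roots:
  fixes p q :: "real poly"
  assumes "p \<noteq> 0" "q \<noteq> 0" "poly q 0 \<noteq> 0"
  obtains s where "s > 0" "\<And>x. poly p (x / s) = 0 \<Longrightarrow> poly q x \<noteq> 0"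
proof -
  \<comment> \<open>A root \<open>x = 0\<close> contributes the ratio 0, by the convention on
    division by zero, and so excludes no positive \<open>s\<close>.\<close>
  let ?B = "(\<lambda>(x, y). y / x) ` ({x. poly p x = 0} \<times> {y. poly q y = 0})"
  have "finite ?B" using assms by (intro finite_imageI finite_cartesian_product poly_roots_finite)
  then have "infinite ({0<..} - ?B)" using infinite_Ioi[of "0::real"] by (rule Diff_infinite_finite)
  then have "{0<..} - ?B \<noteq> {}" by (metis finite.emptyI)
  then obtain s where s: "s > 0" "s \<notin> ?B" by auto
  have "poly q x \<noteq> 0" if "poly p (x / s) = 0" for x
  proof
    assume q: "poly q x = 0"
    then have "x \<noteq> 0" using assms(3) by auto
    then have "s = x / (x / s)" using s by simp
    then have "s \<in> ?B" using that q by (intro image_eqI[of _ _ "(x / s, x)"]) auto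
    then show False using s by simp
  qed
  then show thesis using that s(1) by blast
qed

text \<open>Finitely many strict inequalities that hold at \<epsilon> = 0 persist nearby by
  continuity, whatever the signs of \<open>g\<close>.\<close>

lemma finite_exists_small_perturbation:
  fixes f g :: "'a \<Rightarrow> real"
  assumes "finite A" "\<And>x. x \<in> A \<Longrightarrow> f x > 0"
  shows "\<exists>\<epsilon>>0. \<forall>x\<in>A. f x + \<epsilon> * g x > 0"
proof -
  have "\<forall>\<^sub>F \<epsilon> in at_right 0. \<forall>x\<in>A. f x + \<epsilon> * g x > 0"
  proof (rule eventually_ball_finite[OF assms(1)], rule ballI)
    fix x assume "x \<in> A"
    have "((\<lambda>\<epsilon>. f x + \<epsilon> * g x) \<longlongrightarrow> f x + 0 * g x) (at_right 0)"
      by (intro tendsto_intros)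
    then show "\<forall>\<^sub>F \<epsilon> in at_right 0. f x + \<epsilon> * g x > 0"
      using assms(2)[OF \<open>x \<in> A\<close>] by (auto intro: order_tendstoD(1))
  qed
  then have "\<forall>\<^sub>F \<epsilon> in at_right 0. \<epsilon> > 0 \<and> (\<forall>x\<in>A. f x + \<epsilon> * g x > 0)"
    using eventually_at_right_less[of "0::real"] by eventually_elim auto
  then show ?thesis using eventually_happens'[of "at_right (0::real)"] by auto
qed

section \<open>Matching polynomials of induced subgraphs\<close>

lemma is_matching_card_Union:
  assumes "is_matching E M" "\<And>e. e \<in> E \<Longrightarrow> card e = 2"
  shows "card (\<Union>M) = 2 * card M"
proof -
  have M: "pairwise disjnt M" "\<And>e. e \<in> M \<Longrightarrow> card e = 2"
    using assms by (auto simp: is_matching_def)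
  have "card (\<Union>M) = sum card M"
    using M card_ge_0_finite by (intro card_Union_disjoint) force+
  then show ?thesis using M by simp
qed

lemma is_matching_empty [simp]: "is_matching E {}"
  by (simp add: is_matching_def)

lemma finite_matchings: "finite E \<Longrightarrow> finite {M. is_matching E M}"
  by (rule finite_subset[of _ "Pow E"]) (auto simp: is_matching_def)

text \<open>With the signs moved into the products and the sums over \<open>k\<close> merged,
  identities between matching polynomials reduce to bijections between sets of matchings.\<close>

lemma matching_poly_eq_sum:
  assumes "finite S" "\<And>e. e \<in> E \<Longrightarrow> card e = 2" "E \<subseteq> Pow S"
  shows "matching_poly S E w =
    (\<Sum>M | is_matching E M. monom (\<Prod>e\<in>M. - w e) (card S - 2 * card M))"
proof -
  have finE: "finite E" using assms by (auto intro: finite_subset)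
  have fin: "finite {M. is_matching E M}" using finite_matchings[OF finE] .
  have bound: "card M \<le> card S div 2" if "is_matching E M" for M
  proof -
    have "\<Union>M \<subseteq> S" using that assms by (auto simp: is_matching_def)
    then have "card (\<Union>M) \<le> card S" using assms(1) by (rule card_mono[rotated])
    then show ?thesis using is_matching_card_Union[OF that assms(2)] by simp
  qed
  have "(\<Sum>M | is_matching E M. monom (\<Prod>e\<in>M. - w e) (card S - 2 * card M)) =
    (\<Sum>k = 0..card S div 2. \<Sum>M | M \<in> {M. is_matching E M} \<and> card M = k.
        monom (\<Prod>e\<in>M. - w e) (card S - 2 * card M))"
    using fin bound by (intro sum.group[symmetric]) auto
  also have "\<dots> = matching_poly S E w"
    unfolding matching_poly_def matching_weight_def
    by (intro sum.cong refl) (auto simp: prod_uminus sum_distrib_left monom_sum intro!: sum.cong)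
  finally show ?thesis by simp
qed

text \<open>The edge set and the weights stay fixed while the vertex set varies, so vertex deletions
  and branches become set differences.\<close>

definition sub_mpoly :: "'a set set \<Rightarrow> ('a set \<Rightarrow> real) \<Rightarrow> 'a set \<Rightarrow> real poly" where
  "sub_mpoly E w S = matching_poly S (E \<inter> Pow S) w"

lemma sub_mpoly_eq_sum:
  assumes "finite S" "\<And>e. e \<in> E \<Longrightarrow> card e = 2"
  shows "sub_mpoly E w S =
    (\<Sum>M | is_matching (E \<inter> Pow S) M. monom (\<Prod>e\<in>M. - w e) (card S - 2 * card M))"
  unfolding sub_mpoly_def using assms by (intro matching_poly_eq_sum) auto

lemma is_matching_finite: "finite S \<Longrightarrow> is_matching (E \<inter> Pow S) M \<Longrightarrow> finite M"
  by (auto simp: is_matching_def intro: finite_subset[of M "Pow S"])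

lemma is_matching_card_le:
  assumes "finite S" "\<And>e. e \<in> E \<Longrightarrow> card e = 2" "is_matching (E \<inter> Pow S) M"
  shows "2 * card M \<le> card S"
proof -
  have "card (\<Union>M) \<le> card S"
    using assms by (intro card_mono) (auto simp: is_matching_def)
  then show ?thesis using is_matching_card_Union[OF assms(3)] assms(2) by simp
qed

lemma sub_mpoly_cong:
  assumes "\<And>e. e \<in> E \<Longrightarrow> e \<subseteq> S \<Longrightarrow> w e = w' e"
  shows "sub_mpoly E w S = sub_mpoly E w' S"
  unfolding sub_mpoly_def matching_poly_def matching_weight_def
  using assms by (intro sum.cong refl arg_cong2[of _ _ _ _ monom] arg_cong2[of _ _ _ _ "(*)"] prod.cong)
    (auto simp: is_matching_def)

text \<open>Without crossing edges, a matching is uniquely a matching on \<open>A\<close> together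
  with one on \<open>B\<close>; weights multiply and exponents add.\<close>

lemma sub_mpoly_Un:
  assumes "finite A" "finite B" "A \<inter> B = {}" and E: "\<And>e. e \<in> E \<Longrightarrow> card e = 2"
    and cross: "\<And>e. e \<in> E \<Longrightarrow> e \<subseteq> A \<union> B \<Longrightarrow> e \<subseteq> A \<or> e \<subseteq> B"
  shows "sub_mpoly E w (A \<union> B) = sub_mpoly E w A * sub_mpoly E w B"
proof -
  let ?X = "\<lambda>S. {M. is_matching (E \<inter> Pow S) M}"
  let ?f = "\<lambda>S M. monom (\<Prod>e\<in>M. - w e) (card S - 2 * card M)"
  \<comment> \<open>As \<open>A\<close> and \<open>B\<close> are disjoint, only an empty edge could
    lie inside both.\<close>
  have ne: "{} \<notin> E" using E by fastforce
  have AB: "e \<notin> E" if "e \<subseteq> A" "e \<subseteq> B" for e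
  proof -
    have "e \<subseteq> A \<inter> B" using that by blast
    then show ?thesis using assms(3) ne by auto
  qed
  have disj: "M \<inter> Pow B = {}" "N \<inter> Pow A = {}" "M \<inter> N = {}" if "M \<in> ?X A" "N \<in> ?X B" for M N
  proof -
    have M: "M \<subseteq> E \<inter> Pow A" and N: "N \<subseteq> E \<inter> Pow B" using that by (simp_all add: is_matching_def)
    have "E \<inter> Pow A \<inter> Pow B = {}" using AB by auto
    then show "M \<inter> Pow B = {}" "N \<inter> Pow A = {}" "M \<inter> N = {}"
      using M N by blast+
  qed
  have "sub_mpoly E w A * sub_mpoly E w B = (\<Sum>M\<in>?X A. \<Sum>N\<in>?X B. ?f A M * ?f B N)"
    using assms by (simp add: sub_mpoly_eq_sum sum_product)
  also have "\<dots> = (\<Sum>(M, N)\<in>?X A \<times> ?X B. ?f A M * ?f B N)"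
    by (rule sum.cartesian_product)
  also have "\<dots> = (\<Sum>M\<in>?X (A \<union> B). ?f (A \<union> B) M)"
  proof (rule sum.reindex_bij_witness[where i = "\<lambda>M. (M \<inter> Pow A, M \<inter> Pow B)" and j = "\<lambda>(M, N). M \<union> N"])
    fix x assume x: "x \<in> ?X A \<times> ?X B"
    obtain M N where x: "x = (M, N)" and M: "M \<in> ?X A" and N: "N \<in> ?X B" using x by auto
    show "((case x of (M, N) \<Rightarrow> M \<union> N) \<inter> Pow A, (case x of (M, N) \<Rightarrow> M \<union> N) \<inter> Pow B) = x"
      using M N disj(1,2)[OF M N] by (auto simp: x is_matching_def)
    have MA: "M \<subseteq> E \<inter> Pow A" "pairwise disjnt M" and NB: "N \<subseteq> E \<inter> Pow B" "pairwise disjnt N"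
      using M N by (auto simp: is_matching_def)
    have "disjnt e f" if "e \<in> M" "f \<in> N" for e f
    proof -
      have "e \<subseteq> A" "f \<subseteq> B" using that MA NB by auto
      then show ?thesis using assms(3) unfolding disjnt_def by blast
    qed
    then have "pairwise disjnt (M \<union> N)"
      using MA(2) NB(2) unfolding pairwise_def by (auto simp: disjnt_sym)
    then show "(case x of (M, N) \<Rightarrow> M \<union> N) \<in> ?X (A \<union> B)"
      using MA NB by (auto simp: x is_matching_def)
    have fin: "finite M" "finite N" using M N assms(1,2) is_matching_finite by auto
    \<comment> \<open>Subtraction is truncated, so the exponents add up only because each matching
      fits into its side.\<close>
    have "2 * card M \<le> card A" "2 * card N \<le> card B"
      using M N assms is_matching_card_le[of A E M] is_matching_card_le[of B E N] by auto
    then show "?f (A \<union> B) (case x of (M, N) \<Rightarrow> M \<union> N) = (case x of (M, N) \<Rightarrow> ?f A M * ?f B N)"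
      using fin disj(3)[OF M N] assms(1-3)
      by (simp add: x mult_monom card_Un_disjoint prod.union_disjoint add.commute)
  next
    fix M assume M: "M \<in> ?X (A \<union> B)"
    then have "M \<subseteq> Pow A \<union> Pow B" using cross by (auto simp: is_matching_def)
    then show "(case (M \<inter> Pow A, M \<inter> Pow B) of (M, N) \<Rightarrow> M \<union> N) = M" by auto
    show "(M \<inter> Pow A, M \<inter> Pow B) \<in> ?X A \<times> ?X B"
      using M by (auto simp: is_matching_def pairwise_def)
  qed
  also have "\<dots> = sub_mpoly E w (A \<union> B)"
    using assms by (simp add: sub_mpoly_eq_sum)
  finally show ?thesis by simp
qed

text \<open>A matching either avoids \<open>v\<close> or contains \<open>{u, v}\<close> for exactly
  one \<open>u\<close>; removing that edge leaves a matching on \<open>S - {u, v}\<close> and splits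
  off the factor \<open>- w {u, v}\<close>.\<close>

lemma sub_mpoly_delete_vertex:
  assumes "finite S" "v \<in> S" and E: "\<And>e. e \<in> E \<Longrightarrow> card e = 2"
  shows "sub_mpoly E w S = [:0, 1:] * sub_mpoly E w (S - {v}) -
    (\<Sum>u | u \<in> S \<and> {u, v} \<in> E. smult (w {u, v}) (sub_mpoly E w (S - {u, v})))"
proof -
  let ?X = "\<lambda>S. {M. is_matching (E \<inter> Pow S) M}"
  let ?f = "\<lambda>S M. monom (\<Prod>e\<in>M. - w e) (card S - 2 * card M)"
  let ?U = "{u. u \<in> S \<and> {u, v} \<in> E}"
  have finX: "finite (?X T)" if "finite T" for T
    using finite_matchings[of "E \<inter> Pow T"] that by simp
  have neq: "u \<noteq> v" if "{u, v} \<in> E" for u using E[OF that] by auto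
  have pos: "card S > 0" using assms card_gt_0_iff by blast
  have "sub_mpoly E w S = (\<Sum>M\<in>?X S. ?f S M)"
    using assms by (simp add: sub_mpoly_eq_sum)
  also have "\<dots> = (\<Sum>M\<in>?X (S - {v}) \<union> (?X S - ?X (S - {v})). ?f S M)"
    by (rule sum.cong) (auto simp: is_matching_def)
  also have "\<dots> = (\<Sum>M\<in>?X (S - {v}). ?f S M) + (\<Sum>M\<in>?X S - ?X (S - {v}). ?f S M)"
    using assms(1) finX by (intro sum.union_disjoint) auto
  also have "(\<Sum>M\<in>?X (S - {v}). ?f S M) = [:0, 1:] * sub_mpoly E w (S - {v})"
  proof -
    have "?f S M = [:0, 1:] * ?f (S - {v}) M" if "M \<in> ?X (S - {v})" for M
    proof -
      \<comment> \<open>This bound prevents truncation, so restoring \<open>v\<close> raises the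
        exponent by exactly one, which is the factor \<open>x\<close>.\<close>
      have "2 * card M \<le> card (S - {v})"
        using that assms by (intro is_matching_card_le[of _ E]) auto
      then have "card S - 2 * card M = Suc (card (S - {v}) - 2 * card M)"
        using assms pos by simp
      then show ?thesis by (simp add: monom_Suc)
    qed
    then have "(\<Sum>M\<in>?X (S - {v}). ?f S M) = (\<Sum>M\<in>?X (S - {v}). [:0, 1:] * ?f (S - {v}) M)"
      by (rule sum.cong[OF refl])
    also have "\<dots> = [:0, 1:] * (\<Sum>M\<in>?X (S - {v}). ?f (S - {v}) M)"
      by (rule sum_distrib_left[symmetric])
    finally show ?thesis using assms by (simp add: sub_mpoly_eq_sum)
  qed
  also have "(\<Sum>M\<in>?X S - ?X (S - {v}). ?f S M) =
    (\<Sum>(u, N)\<in>Sigma ?U (\<lambda>u. ?X (S - {u, v})). ?f S (insert {u, v} N))"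
  proof (rule sum.reindex_bij_betw[symmetric, THEN trans])
    show "bij_betw (\<lambda>(u, N). insert {u, v} N) (Sigma ?U (\<lambda>u. ?X (S - {u, v}))) (?X S - ?X (S - {v}))"
      unfolding bij_betw_def
    proof
      \<comment> \<open>No edge of \<open>N\<close> contains \<open>v\<close>, so
        \<open>{u, v}\<close> is the only edge at \<open>v\<close> in the enlarged matching and
        determines \<open>u\<close>.\<close>
      have inj: "u = u' \<and> N = N'"
        if "is_matching (E \<inter> Pow (S - {u, v})) N" "is_matching (E \<inter> Pow (S - {u', v})) N'"
          "insert {u, v} N = insert {u', v} N'" for u u' N N'
      proof -
        have "{u, v} \<notin> N" "{u', v} \<notin> N'" "{u, v} \<notin> N'" using that(1,2) by (auto simp: is_matching_def)
        then have "{u, v} = {u', v}" using that(3) by auto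
        then show ?thesis using that(3) \<open>{u, v} \<notin> N\<close> \<open>{u', v} \<notin> N'\<close>
          by (metis doubleton_eq_iff insert_ident)
      qed
      show "inj_on (\<lambda>(u, N). insert {u, v} N) (Sigma ?U (\<lambda>u. ?X (S - {u, v})))"
      proof (rule inj_onI)
        fix x y assume xy: "x \<in> Sigma ?U (\<lambda>u. ?X (S - {u, v}))" "y \<in> Sigma ?U (\<lambda>u. ?X (S - {u, v}))"
          and eq: "(case x of (u, N) \<Rightarrow> insert {u, v} N) = (case y of (u, N) \<Rightarrow> insert {u, v} N)"
        obtain u N u' N' where "x = (u, N)" "y = (u', N')" by fastforce
        then show "x = y" using xy eq inj[of u N u' N'] by simp
      qed
      show "(\<lambda>(u, N). insert {u, v} N) ` Sigma ?U (\<lambda>u. ?X (S - {u, v})) = ?X S - ?X (S - {v})"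
      proof (intro equalityI subsetI)
        fix M assume "M \<in> (\<lambda>(u, N). insert {u, v} N) ` Sigma ?U (\<lambda>u. ?X (S - {u, v}))"
        then obtain u N where "M = insert {u, v} N" "u \<in> S" "{u, v} \<in> E" "N \<in> ?X (S - {u, v})"
          by auto
        then show "M \<in> ?X S - ?X (S - {v})"
          using assms(2) by (auto simp: is_matching_def pairwise_insert disjnt_def)
      next
        fix M assume M: "M \<in> ?X S - ?X (S - {v})"
        then obtain e where e: "e \<in> M" "v \<in> e" by (auto simp: is_matching_def)
        have "e \<in> E" "e \<subseteq> S" using M e by (auto simp: is_matching_def)
        then obtain u where u: "e = {u, v}"
          using E[of e] e(2) by (auto simp: card_2_iff)
        have M': "M \<subseteq> E \<inter> Pow S" "pairwise disjnt M" using M by (auto simp: is_matching_def)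
        have "f \<subseteq> S - {u, v}" if "f \<in> M - {e}" for f
        proof -
          have "disjnt f e" using M'(2) that e(1) by (auto dest: pairwiseD)
          moreover have "f \<subseteq> S" using M' that by auto
          ultimately show ?thesis unfolding u disjnt_def by auto
        qed
        then have "M - {e} \<in> ?X (S - {u, v})"
          using M' pairwise_subset[of disjnt M "M - {e}"] unfolding is_matching_def by blast
        moreover have "u \<in> ?U" using u \<open>e \<in> E\<close> \<open>e \<subseteq> S\<close> by auto
        ultimately show "M \<in> (\<lambda>(u, N). insert {u, v} N) ` Sigma ?U (\<lambda>u. ?X (S - {u, v}))"
          using e u by (intro image_eqI[of _ _ "(u, M - {e})"]) auto
      qed
    qed
  qed (auto simp: case_prod_unfold)
  also have "\<dots> = (\<Sum>u\<in>?U. \<Sum>N\<in>?X (S - {u, v}). ?f S (insert {u, v} N))"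
    using assms(1) finX by (intro sum.Sigma[symmetric]) auto
  also have "\<dots> = (\<Sum>u\<in>?U. - smult (w {u, v}) (sub_mpoly E w (S - {u, v})))"
  proof (rule sum.cong[OF refl])
    fix u assume u: "u \<in> ?U"
    have "?f S (insert {u, v} N) = smult (- w {u, v}) (?f (S - {u, v}) N)"
      if N: "N \<in> ?X (S - {u, v})" for N
    proof -
      have "{u, v} \<notin> N" using N by (auto simp: is_matching_def)
      moreover have "finite N" using N assms(1) is_matching_finite[of "S - {u, v}"] by auto
      moreover have "card (S - {u, v}) = card S - 2"
        using u neq assms by (subst card_Diff_subset) auto
      ultimately show ?thesis by (simp add: smult_monom)
    qed
    then have "(\<Sum>N\<in>?X (S - {u, v}). ?f S (insert {u, v} N)) =
        (\<Sum>N\<in>?X (S - {u, v}). smult (- w {u, v}) (?f (S - {u, v}) N))"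
      by (rule sum.cong[OF refl])
    also have "\<dots> = smult (- w {u, v}) (\<Sum>N\<in>?X (S - {u, v}). ?f (S - {u, v}) N)"
      by (intro poly_eqI) (simp add: coeff_sum sum_distrib_left sum_negf)
    finally show "(\<Sum>N\<in>?X (S - {u, v}). ?f S (insert {u, v} N)) = - smult (w {u, v}) (sub_mpoly E w (S - {u, v}))"
      using assms by (simp add: sub_mpoly_eq_sum)
  qed
  finally show ?thesis by (simp add: sum_negf)
qed

section \<open>Degree, parity and rescaling of matching polynomials\<close>

text \<open>Every nonempty matching lowers the exponent, so only the empty one contributes to the
  top coefficient.\<close>

lemma sub_mpoly_monic:
  assumes "finite S" and E: "\<And>e. e \<in> E \<Longrightarrow> card e = 2"
  shows "degree (sub_mpoly E w S) = card S" "lead_coeff (sub_mpoly E w S) = 1"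
proof -
  have fin: "finite {M. is_matching (E \<inter> Pow S) M}"
    using finite_matchings[of "E \<inter> Pow S"] assms(1) by simp
  have eq: "sub_mpoly E w S =
      (\<Sum>M | is_matching (E \<inter> Pow S) M. monom (\<Prod>e\<in>M. - w e) (card S - 2 * card M))"
    using assms by (rule sub_mpoly_eq_sum)
  have "coeff (sub_mpoly E w S) (card S) =
      (\<Sum>M | is_matching (E \<inter> Pow S) M. if M = {} then 1 else 0)"
    unfolding eq coeff_sum
  proof (rule sum.cong[OF refl])
    fix M assume M: "M \<in> {M. is_matching (E \<inter> Pow S) M}"
    then have "finite M" "2 * card M \<le> card S"
      using assms is_matching_finite[of S E] is_matching_card_le[of S E] by auto
    then have "card S - 2 * card M = card S \<longleftrightarrow> M = {}"
      by (auto simp flip: card_0_eq)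
    then show "coeff (monom (\<Prod>e\<in>M. - w e) (card S - 2 * card M)) (card S) = (if M = {} then 1 else 0)"
      by auto
  qed
  also have "\<dots> = 1" using fin by (subst sum.delta) auto
  finally have c: "coeff (sub_mpoly E w S) (card S) = 1" .
  have "degree (sub_mpoly E w S) \<le> card S"
    unfolding eq
    by (rule degree_sum_le[OF fin]) (rule order.trans[OF degree_monom_le], simp)
  then show "degree (sub_mpoly E w S) = card S"
    using c le_degree[of "sub_mpoly E w S" "card S"] by auto
  then show "lead_coeff (sub_mpoly E w S) = 1" using c by simp
qed

lemma sub_mpoly_coeff_1:
  assumes "even (card S)"
  shows "coeff (sub_mpoly E w S) 1 = 0"
proof -
  have "card S - 2 * k \<noteq> 1" for k using assms by presburger
  then show ?thesis by (simp add: sub_mpoly_def matching_poly_def coeff_sum)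
qed

text \<open>With \<open>n = card S\<close>, a matching of \<open>k\<close> edges gains the factor
  \<open>s^(2k)\<close>, which is \<open>s^n * (1/s)^(n - 2k)\<close>.\<close>

lemma poly_sub_mpoly_scale:
  assumes "s > 0" "finite S" and E: "\<And>e. e \<in> E \<Longrightarrow> card e = 2"
  shows "sub_mpoly E (\<lambda>e. s\<^sup>2 * w e) S = smult (s ^ card S) (pcompose (sub_mpoly E w S) [:0, 1 / s:])"
proof -
  have eq: "sub_mpoly E w S =
      (\<Sum>M | is_matching (E \<inter> Pow S) M. monom (\<Prod>e\<in>M. - w e) (card S - 2 * card M))" for w
    using assms(2) E by (rule sub_mpoly_eq_sum)
  have "poly (sub_mpoly E (\<lambda>e. s\<^sup>2 * w e) S) x = s ^ card S * poly (sub_mpoly E w S) (x / s)" for x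
    unfolding eq poly_sum sum_distrib_left
  proof (rule sum.cong[OF refl])
    fix M assume M: "M \<in> {M. is_matching (E \<inter> Pow S) M}"
    have le: "2 * card M \<le> card S" using M assms is_matching_card_le[of S E] by auto
    have "s ^ card S = s ^ (2 * card M) * s ^ (card S - 2 * card M)"
      using le by (simp flip: power_add)
    moreover have "(\<Prod>e\<in>M. - (s\<^sup>2 * w e)) = s ^ (2 * card M) * (\<Prod>e\<in>M. - w e)"
      by (simp add: prod_uminus prod.distrib power_mult)
    ultimately show "poly (monom (\<Prod>e\<in>M. - (s\<^sup>2 * w e)) (card S - 2 * card M)) x =
       s ^ card S * poly (monom (\<Prod>e\<in>M. - w e) (card S - 2 * card M)) (x / s)"
      using assms(1) by (simp add: poly_monom power_divide)
  qed
  then show ?thesis by (intro poly_eq_poly_eq_iff[THEN iffD1] ext) (simp add: poly_pcompose)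
qed

section \<open>Branches at a vertex\<close>

text \<open>By \<open>cross\<close>, \<open>H\<close> is a union of components of the graph on
  \<open>S - {v}\<close>. In the expansion at \<open>v\<close>, a neighbour in \<open>H\<close>
  leaves the whole factor of \<open>S - H - {v}\<close>, and any other neighbour leaves the whole
  factor of \<open>H\<close>.\<close>

lemma sub_mpoly_branch:
  assumes "finite S" "v \<in> S" "H \<subseteq> S - {v}" and E: "\<And>e. e \<in> E \<Longrightarrow> card e = 2"
    and cross: "\<And>e. e \<in> E \<Longrightarrow> e \<subseteq> S - {v} \<Longrightarrow> e \<subseteq> H \<or> e \<subseteq> S - H"
  shows "sub_mpoly E w (S - {v}) = sub_mpoly E w H * sub_mpoly E w (S - H - {v})"
    and "sub_mpoly E w S = sub_mpoly E w H * sub_mpoly E w (S - H) - sub_mpoly E w (S - H - {v}) *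
      (\<Sum>u | u \<in> H \<and> {u, v} \<in> E. smult (w {u, v}) (sub_mpoly E w (H - {u})))"
proof -
  let ?F = "sub_mpoly E w"
  let ?K = "S - H"
  have finH: "finite H" using assms finite_subset by blast
  have prod: "?F (A \<union> B) = ?F A * ?F B" if "A \<subseteq> H" "B \<subseteq> ?K - {v}" for A B
  proof (rule sub_mpoly_Un)
    show "finite A" "finite B" using that assms(1) finH by (auto intro: finite_subset)
    show "A \<inter> B = {}" using that by auto
    fix e assume e: "e \<in> E" "e \<subseteq> A \<union> B"
    then have "e \<subseteq> S - {v}" using that assms(3) by blast
    from cross[OF e(1) this] show "e \<subseteq> A \<or> e \<subseteq> B" using e(2) that by blast
  qed (use E in auto)
  have "S - {v} = H \<union> (?K - {v})" using assms(3) by auto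
  then show Sv: "?F (S - {v}) = ?F H * ?F (?K - {v})" using prod by simp
  let ?t = "\<lambda>u. smult (w {u, v}) (?F (S - {u, v}))"
  have "(\<Sum>u | u \<in> S \<and> {u, v} \<in> E. ?t u) =
      (\<Sum>u \<in> {u. u \<in> H \<and> {u, v} \<in> E} \<union> {u. u \<in> ?K \<and> {u, v} \<in> E}. ?t u)"
    using assms(3) by (intro sum.cong) auto
  also have "\<dots> = (\<Sum>u | u \<in> H \<and> {u, v} \<in> E. ?t u) + (\<Sum>u | u \<in> ?K \<and> {u, v} \<in> E. ?t u)"
    using assms(1) finH by (intro sum.union_disjoint) auto
  also have "(\<Sum>u | u \<in> H \<and> {u, v} \<in> E. ?t u) =
      ?F (?K - {v}) * (\<Sum>u | u \<in> H \<and> {u, v} \<in> E. smult (w {u, v}) (?F (H - {u})))"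
    unfolding sum_distrib_left
  proof (rule sum.cong[OF refl])
    fix u assume "u \<in> {u. u \<in> H \<and> {u, v} \<in> E}"
    then have eq: "S - {u, v} = (H - {u}) \<union> (?K - {v})" using assms(3) by auto
    have "?F (H - {u} \<union> (?K - {v})) = ?F (H - {u}) * ?F (?K - {v})" by (rule prod) auto
    then show "?t u = ?F (?K - {v}) * smult (w {u, v}) (?F (H - {u}))"
      unfolding eq by (simp add: mult.commute)
  qed
  also have "(\<Sum>u | u \<in> ?K \<and> {u, v} \<in> E. ?t u) =
      ?F H * (\<Sum>u | u \<in> ?K \<and> {u, v} \<in> E. smult (w {u, v}) (?F (?K - {u, v})))"
    unfolding sum_distrib_left
  proof (rule sum.cong[OF refl])
    fix u assume "u \<in> {u. u \<in> ?K \<and> {u, v} \<in> E}"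
    then have eq: "S - {u, v} = H \<union> (?K - {u, v})" using assms(3) by auto
    have "?F (H \<union> (?K - {u, v})) = ?F H * ?F (?K - {u, v})" by (rule prod) auto
    then show "?t u = ?F H * smult (w {u, v}) (?F (?K - {u, v}))"
      unfolding eq by simp
  qed
  finally have sum: "(\<Sum>u | u \<in> S \<and> {u, v} \<in> E. ?t u) =
      ?F (?K - {v}) * (\<Sum>u | u \<in> H \<and> {u, v} \<in> E. smult (w {u, v}) (?F (H - {u}))) +
      ?F H * (\<Sum>u | u \<in> ?K \<and> {u, v} \<in> E. smult (w {u, v}) (?F (?K - {u, v})))" .
  \<comment> \<open>The same recursion at \<open>v\<close> inside \<open>S - H\<close> collects the
    \<open>x\<close> term and the neighbours outside \<open>H\<close> into one polynomial.\<close>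
  have K: "?F ?K = [:0, 1:] * ?F (?K - {v}) -
      (\<Sum>u | u \<in> ?K \<and> {u, v} \<in> E. smult (w {u, v}) (?F (?K - {u, v})))"
    using assms by (intro sub_mpoly_delete_vertex) auto
  have S: "?F S = [:0, 1:] * ?F (S - {v}) - (\<Sum>u | u \<in> S \<and> {u, v} \<in> E. ?t u)"
    using assms(1,2) E by (rule sub_mpoly_delete_vertex)
  show "?F S = ?F H * ?F ?K - ?F (?K - {v}) *
      (\<Sum>u | u \<in> H \<and> {u, v} \<in> E. smult (w {u, v}) (?F (H - {u})))"
    unfolding S Sv sum K by (simp only: algebra_simps)
qed

text \<open>At a root of the polynomial of \<open>H\<close> the sign is decided by the term of the edge \<open>{u, v}\<close>, because
  the other edges between \<open>v\<close> and \<open>H\<close> get a tiny weight \<open>\<epsilon>\<close>. The parity assumption keeps \<open>0\<close> from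
  being a root on the \<open>S - H - {v}\<close> side, so that scaling the weights on \<open>H\<close> makes the two root sets disjoint.\<close>

lemma exists_weighting_join:
  fixes E :: "'a set set"
  assumes fin: "finite S" and v: "v \<in> S" and H: "H \<subseteq> S - {v}" and u: "u \<in> H" "{u, v} \<in> E"
    and E: "\<And>e. e \<in> E \<Longrightarrow> card e = 2"
    and cross: "\<And>e. e \<in> E \<Longrightarrow> e \<subseteq> S - {v} \<Longrightarrow> e \<subseteq> H \<or> e \<subseteq> S - H"
    and even: "even (card (S - H - {v}))"
    and wH: "\<And>e. wH e > 0" "interlaces (sub_mpoly E wH (H - {u})) (sub_mpoly E wH H)"
    and wK: "\<And>e. wK e > 0" "interlaces (sub_mpoly E wK (S - H - {v})) (sub_mpoly E wK (S - H))"
  shows "\<exists>w. (\<forall>e. w e > 0) \<and> interlaces (sub_mpoly E w (S - {v})) (sub_mpoly E w S)"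
proof -
  define k k0 where "k = sub_mpoly E wK (S - H)" and "k0 = sub_mpoly E wK (S - H - {v})"
  have finH: "finite H" using fin H finite_subset by blast
  have deg: "degree (sub_mpoly E w T) = card T" and lc: "lead_coeff (sub_mpoly E w T) = 1"
    and nz: "sub_mpoly E w T \<noteq> 0" if "T \<subseteq> S" for w T
  proof -
    have "finite T" using fin that finite_subset by blast
    then show "degree (sub_mpoly E w T) = card T" "lead_coeff (sub_mpoly E w T) = 1"
      using E by (auto intro: sub_mpoly_monic)
    then show "sub_mpoly E w T \<noteq> 0" by auto
  qed
  have sub: "H \<subseteq> S" "H - {x} \<subseteq> S" "S - H - {v} \<subseteq> S" "S - H \<subseteq> S" for x using H by auto
  have "poly k0 0 \<noteq> 0"
    using wK(2) sub_mpoly_coeff_1[OF even] unfolding k0_def by (rule interlaces_coeff_1_root)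
  then obtain s where s: "s > 0" "\<And>x. poly (sub_mpoly E wH H) (x / s) = 0 \<Longrightarrow> poly k0 x \<noteq> 0"
    using exists_scaling_disjoint_roots[of "sub_mpoly E wH H" k0] nz sub unfolding k0_def by metis
  \<comment> \<open>The factor is squared because an edge covers two vertices; the roots then scale
    by \<open>s\<close> itself.\<close>
  define w1 where "w1 e = s\<^sup>2 * wH e" for e
  have scale: "sub_mpoly E w1 T = smult (s ^ card T) (pcompose (sub_mpoly E wH T) [:0, 1 / s:])"
    if "T \<subseteq> S" for T
  proof -
    have "finite T" using fin that finite_subset by blast
    then show ?thesis unfolding w1_def using s(1) E by (intro poly_sub_mpoly_scale)
  qed
  define h where "h = sub_mpoly E w1 H"
  have hk0: "poly k0 x \<noteq> 0" if "poly h x = 0" for x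
    using s that by (auto simp: h_def scale[OF sub(1)] poly_pcompose)
  have inth: "interlaces (sub_mpoly E w1 (H - {u})) h"
    unfolding h_def scale[OF sub(1)] scale[OF sub(2)] using wH(2) s(1) by (intro interlaces_scale) auto
  have cardH: "card H = Suc (card (H - {u}))"
    using finH u(1) by (metis card_Suc_Diff1)
  have cardh: "card {x. poly h x = 0} = card H"
    and posh: "\<And>x. poly h x = 0 \<Longrightarrow> poly (sub_mpoly E w1 (H - {u})) x * poly (pderiv h) x > 0"
    using interlaces_dual[OF lc[OF sub(1)] lc[OF sub(2)] _ deg[OF sub(2)] inth[unfolded h_def]]
    unfolding deg[OF sub(1)] h_def using cardH by auto
  define N where "N = {x. x \<in> H \<and> {x, v} \<in> E}"
  have "finite {x. poly h x = 0}" using nz[OF sub(1)] unfolding h_def by (rule poly_roots_finite)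
  \<comment> \<open>The perturbation term gathers all neighbours of \<open>v\<close> in
    \<open>H\<close> other than \<open>u\<close>.\<close>
  then obtain \<epsilon> where \<epsilon>: "\<epsilon> > 0" "\<And>x. poly h x = 0 \<Longrightarrow>
    poly (sub_mpoly E w1 (H - {u})) x * poly (pderiv h) x +
      \<epsilon> * ((\<Sum>y\<in>N - {u}. poly (sub_mpoly E w1 (H - {y})) x) * poly (pderiv h) x) > 0"
    using finite_exists_small_perturbation[of "{x. poly h x = 0}"
      "\<lambda>x. poly (sub_mpoly E w1 (H - {u})) x * poly (pderiv h) x"
      "\<lambda>x. (\<Sum>y\<in>N - {u}. poly (sub_mpoly E w1 (H - {y})) x) * poly (pderiv h) x"] posh
    by blast
  \<comment> \<open>Among edges within \<open>S\<close>, the last case is reached exactly by those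
    from \<open>v\<close> to \<open>H\<close> other than \<open>{u, v}\<close>. The first two cases
    overlap only in the empty set, which is not an edge.\<close>
  define w where "w e = (if e \<subseteq> H then w1 e else if e \<subseteq> S - H then wK e else if e = {u, v} then 1 else \<epsilon>)" for e
  have wpos: "w e > 0" for e using \<epsilon>(1) s(1) wH(1) wK(1) by (simp add: w_def w1_def)
  have w_H: "sub_mpoly E w T = sub_mpoly E w1 T" if "T \<subseteq> H" for T
    using that by (intro sub_mpoly_cong) (auto simp: w_def)
  have w_K: "sub_mpoly E w T = sub_mpoly E wK T" if "T \<subseteq> S - H" for T
  proof (rule sub_mpoly_cong)
    fix e assume e: "e \<in> E" "e \<subseteq> T"
    have "e \<noteq> {}" using E[OF e(1)] by auto
    then have "\<not> e \<subseteq> H" using e that by auto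
    then show "w e = wK e" using e that by (auto simp: w_def)
  qed
  have w_v: "w {x, v} = (if x = u then 1 else \<epsilon>)" if "x \<in> H" for x
    using that H v by (auto simp: w_def doubleton_eq_iff)
  define T where "T = (\<Sum>x\<in>N. smult (w {x, v}) (sub_mpoly E w1 (H - {x})))"
  have q: "sub_mpoly E w (S - {v}) = h * k0"
    using sub_mpoly_branch(1)[of S v H E w] fin v H E cross w_H[of H] w_K[of "S - H - {v}"]
    by (simp add: h_def k0_def)
  have p: "sub_mpoly E w S = h * k - k0 * T"
    using sub_mpoly_branch(2)[of S v H E w] fin v H E cross w_H w_K[of "S - H - {v}"] w_K[of "S - H"]
    by (simp add: h_def k_def k0_def T_def N_def)
  have uN: "u \<in> N" "finite N" using u finH by (auto simp: N_def)
  have "poly T x = poly (sub_mpoly E w1 (H - {u})) x +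
      \<epsilon> * (\<Sum>y\<in>N - {u}. poly (sub_mpoly E w1 (H - {y})) x)" for x
  proof -
    have "poly T x = poly (sub_mpoly E w1 (H - {u})) x +
        (\<Sum>y\<in>N - {u}. w {y, v} * poly (sub_mpoly E w1 (H - {y})) x)"
      unfolding T_def poly_sum using uN u(1) w_v by (simp add: sum.remove[of N u])
    also have "(\<Sum>y\<in>N - {u}. w {y, v} * poly (sub_mpoly E w1 (H - {y})) x) =
        (\<Sum>y\<in>N - {u}. \<epsilon> * poly (sub_mpoly E w1 (H - {y})) x)"
      using w_v by (intro sum.cong) (auto simp: N_def)
    finally show ?thesis by (simp add: sum_distrib_left)
  qed
  then have Tpos: "poly T x * poly (pderiv h) x > 0" if "poly h x = 0" for x
    using \<epsilon>(2)[OF that] by (simp add: algebra_simps)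
  have cardk0: "card {x. poly k0 x = 0} = card (S - H - {v})"
    and negk0: "\<And>x. poly k0 x = 0 \<Longrightarrow> poly k x * poly (pderiv k0) x < 0"
    using wK(2) deg[OF sub(3)] unfolding interlaces_def k_def k0_def by auto
  have "interlaces (h * k0) (h * k - k0 * T)"
    unfolding interlaces_def
  proof (intro conjI allI impI)
    have "h \<noteq> 0" "k0 \<noteq> 0" using nz sub unfolding h_def k0_def by auto
    have "card {x. poly (h * k0) x = 0} = card ({x. poly h x = 0} \<union> {x. poly k0 x = 0})"
      by (rule arg_cong[of _ _ card]) auto
    also have "\<dots> = card H + card (S - H - {v})"
      using hk0 \<open>h \<noteq> 0\<close> \<open>k0 \<noteq> 0\<close> cardh cardk0 by (subst card_Un_disjoint) (auto simp: poly_roots_finite)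
    also have "\<dots> = degree (h * k0)"
      using \<open>h \<noteq> 0\<close> \<open>k0 \<noteq> 0\<close> deg[OF sub(1)] deg[OF sub(3)] by (simp add: degree_mult_eq h_def k0_def)
    finally show "card {x. poly (h * k0) x = 0} = degree (h * k0)" .
    fix x assume "poly (h * k0) x = 0"
    then consider "poly h x = 0" | "poly k0 x = 0" by auto
    then show "poly (h * k - k0 * T) x * poly (pderiv (h * k0)) x < 0"
    proof cases
      case 1
      \<comment> \<open>At a root of \<open>h\<close> the first factor is \<open>- k0 * T\<close>
        and the second is \<open>k0\<close> times the derivative of \<open>h\<close>.\<close>
      have "(poly k0 x)\<^sup>2 * (poly T x * poly (pderiv h) x) > 0"
        using Tpos[OF 1] hk0[OF 1] by simp
      then show ?thesis using 1 by (simp add: pderiv_mult power2_eq_square algebra_simps)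
    next
      case 2
      \<comment> \<open>At a root of \<open>k0\<close> both factors carry \<open>h\<close>, so its
        square multiplies the sign condition inherited from \<open>S - H\<close>.\<close>
      have "poly h x \<noteq> 0" using hk0 2 by auto
      then have "(poly h x)\<^sup>2 * (poly k x * poly (pderiv k0) x) < 0"
        using negk0[OF 2] by (simp add: mult_pos_neg)
      then show ?thesis using 2 by (simp add: pderiv_mult power2_eq_square algebra_simps)
    qed
  qed
  then show ?thesis using wpos unfolding q[symmetric] p[symmetric] by blast
qed

section \<open>Splitting a connected graph, and the induction\<close>

text \<open>Keeping both ends in \<open>S\<close> makes the closure describe paths of the induced
  subgraph; connectedness is then expressed as reaching a chosen root vertex.\<close>

definition adjacent_within :: "'a set set \<Rightarrow> 'a set \<Rightarrow> 'a rel" where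
  "adjacent_within E S = {(x, y). {x, y} \<in> E \<and> x \<in> S \<and> y \<in> S}"

text \<open>Take \<open>H\<close> to be the component of \<open>u\<close> after deleting
  \<open>v\<close>. A path to \<open>v\<close> from outside \<open>H\<close> cannot enter
  \<open>H\<close> before it meets \<open>v\<close>, since any vertex other than \<open>v\<close>
  with a neighbour in \<open>H\<close> is already in \<open>H\<close>; so \<open>S - H\<close> stays
  connected.\<close>

lemma split_off_branch:
  assumes E: "\<And>e. e \<in> E \<Longrightarrow> card e = 2" and "v \<in> S"
    and conn: "\<And>x. x \<in> S \<Longrightarrow> (x, v) \<in> (adjacent_within E S)\<^sup>*"
    and u: "u \<in> S" "{u, v} \<in> E"
  obtains H where "H \<subseteq> S - {v}" "u \<in> H"
    "\<And>x. x \<in> H \<Longrightarrow> (x, u) \<in> (adjacent_within E H)\<^sup>*"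
    "\<And>x. x \<in> S - H \<Longrightarrow> (x, v) \<in> (adjacent_within E (S - H))\<^sup>*"
    "\<And>e. e \<in> E \<Longrightarrow> e \<subseteq> S - {v} \<Longrightarrow> e \<subseteq> H \<or> e \<subseteq> S - H"
proof
  let ?R = "adjacent_within E (S - {v})"
  let ?H = "{x \<in> S - {v}. (x, u) \<in> ?R\<^sup>*}"
  show "?H \<subseteq> S - {v}" by auto
  have "u \<noteq> v" using E[OF u(2)] by auto
  then show "u \<in> ?H" using u by auto
  have step: "x \<in> ?H" if "(x, y) \<in> ?R" "y \<in> ?H" for x y
    using that by (auto simp: adjacent_within_def intro: converse_rtrancl_into_rtrancl)
  show "(x, u) \<in> (adjacent_within E ?H)\<^sup>*" if "x \<in> ?H" for x
  proof -
    have "(x, u) \<in> ?R\<^sup>*" using that by simp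
    then show ?thesis
    proof (induction rule: converse_rtrancl_induct)
      case (step x y)
      then have "(x, y) \<in> adjacent_within E ?H"
        by (auto simp: adjacent_within_def intro: converse_rtrancl_into_rtrancl)
      then show ?case using step.IH by (rule converse_rtrancl_into_rtrancl)
    qed simp
  qed
  show "(x, v) \<in> (adjacent_within E (S - ?H))\<^sup>*" if "x \<in> S - ?H" for x
  proof -
    have "(x, v) \<in> (adjacent_within E S)\<^sup>*" using conn that by simp
    then show ?thesis using that
    proof (induction rule: converse_rtrancl_induct)
      case (step x y)
      show ?case
      \<comment> \<open>The path is cut at its first visit to \<open>v\<close>, after which it might
        enter \<open>H\<close>.\<close>
      proof (cases "x = v")
        case False
        have xy: "{x, y} \<in> E" "x \<in> S" "y \<in> S" using step.hyps by (auto simp: adjacent_within_def)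
        have "y \<notin> ?H"
          using \<open>\<And>x y. (x, y) \<in> ?R \<Longrightarrow> y \<in> ?H \<Longrightarrow> x \<in> ?H\<close>[of x y] xy False step.prems
          by (auto simp: adjacent_within_def)
        then have "(x, y) \<in> adjacent_within E (S - ?H)"
          using xy step.prems by (auto simp: adjacent_within_def)
        moreover have "(y, v) \<in> (adjacent_within E (S - ?H))\<^sup>*"
          using step.IH \<open>y \<notin> ?H\<close> xy by auto
        ultimately show ?thesis by (rule converse_rtrancl_into_rtrancl)
      qed simp
    qed simp
  qed
  fix e assume e: "e \<in> E" "e \<subseteq> S - {v}"
  then obtain a b where ab: "e = {a, b}" using E[OF e(1)] by (auto simp: card_2_iff)
  then have "(a, b) \<in> ?R" "(b, a) \<in> ?R"
    using e by (auto simp: adjacent_within_def insert_commute)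
  then have "a \<in> ?H \<longleftrightarrow> b \<in> ?H" using step by blast
  then show "e \<subseteq> ?H \<or> e \<subseteq> S - ?H" using e ab by auto
qed

text \<open>The root \<open>v\<close> varies in the induction, as \<open>H\<close> is rooted at
  \<open>u\<close> and \<open>S - H\<close> at \<open>v\<close>. The covering alternative is
  inherited: the part of \<open>M\<close> on \<open>H\<close> misses at most \<open>u\<close>, and
  the part on \<open>S - H - {v}\<close> covers it entirely.\<close>

lemma exists_interlacing_weighting:
  assumes E: "\<And>e. e \<in> E \<Longrightarrow> card e = 2"
    and "finite S" "v \<in> S"
    and "\<And>x. x \<in> S \<Longrightarrow> (x, v) \<in> (adjacent_within E S)\<^sup>*"
    and "is_matching E M" "\<Union>M = S \<or> \<Union>M = S - {v}"
  shows "\<exists>w. (\<forall>e. w e > 0) \<and> interlaces (sub_mpoly E w (S - {v})) (sub_mpoly E w S)"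
  using assms(2-)
proof (induction "card S" arbitrary: S v M rule: less_induct)
  case less
  note fin = less.prems(1) and v = less.prems(2) and conn = less.prems(3)
    and M = less.prems(4) and cover = less.prems(5)
  show ?case
  proof (cases "S = {v}")
    case True
    \<comment> \<open>Deleting the only vertex leaves the polynomial 1, which has no roots, so the
      sign condition is vacuous.\<close>
    have "degree (sub_mpoly E (\<lambda>_. 1) {}) = 0" "lead_coeff (sub_mpoly E (\<lambda>_. 1) {}) = 1"
      using sub_mpoly_monic[of "{}" E] E by auto
    then have "sub_mpoly E (\<lambda>_. 1) {} = 1" by (auto elim: degree_eq_zeroE)
    then show ?thesis using True by (intro exI[of _ "\<lambda>_. 1"]) (simp add: interlaces_def)
  next
    case False
    \<comment> \<open>Branching along the matching edge at \<open>v\<close>, if there is one, makes \<open>S - H - {v}\<close> perfectly matched.\<close>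
    obtain u where u: "u \<in> S" "{u, v} \<in> E" and uM: "\<Union>M = S \<Longrightarrow> {u, v} \<in> M"
    proof (cases "\<Union>M = S")
      case True
      then obtain e where e: "e \<in> M" "v \<in> e" using v by auto
      then have "e \<in> E" "e \<subseteq> S" using M True by (auto simp: is_matching_def)
      then obtain u where "e = {u, v}" using E[of e] e(2) by (auto simp: card_2_iff)
      then show thesis using that[of u] e \<open>e \<in> E\<close> \<open>e \<subseteq> S\<close> by auto
    next
      case nm: False
      obtain x where x: "x \<in> S" "x \<noteq> v" using False v by auto
      from conn[OF x(1)] x(2) obtain u where "(u, v) \<in> adjacent_within E S"
        by (auto elim: rtranclE)
      then show thesis using that[of u] nm by (auto simp: adjacent_within_def)
    qed
    obtain H where H: "H \<subseteq> S - {v}" "u \<in> H"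
      "\<And>x. x \<in> H \<Longrightarrow> (x, u) \<in> (adjacent_within E H)\<^sup>*"
      "\<And>x. x \<in> S - H \<Longrightarrow> (x, v) \<in> (adjacent_within E (S - H))\<^sup>*"
      and cross: "\<And>e. e \<in> E \<Longrightarrow> e \<subseteq> S - {v} \<Longrightarrow> e \<subseteq> H \<or> e \<subseteq> S - H"
      using split_off_branch[OF E v conn u] by metis
    have uv: "u \<noteq> v" using E[OF u(2)] by auto
    have ME: "e \<in> E" "e \<subseteq> S" if "e \<in> M" for e
      using that M cover by (auto simp: is_matching_def)
    have dj: "x \<notin> f" if "e \<in> M" "f \<in> M" "e \<noteq> f" "x \<in> e" for e f x
    proof -
      have "disjnt e f" using M that by (auto simp: is_matching_def dest: pairwiseD)
      then show ?thesis using that(4) by (auto simp: disjnt_def)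
    qed
    \<comment> \<open>If \<open>M\<close> is perfect, its only edge at \<open>v\<close> is
      \<open>{u, v}\<close>; otherwise it has none. Every other matching edge thus survives the
      deletion of \<open>v\<close> and falls on one side.\<close>
    have side: "e \<subseteq> H \<or> e \<subseteq> S - H - {v}" if "e \<in> M" "e \<noteq> {u, v}" for e
    proof -
      have "v \<notin> e"
      proof (cases "\<Union>M = S")
        case True
        then show ?thesis using dj[of "{u, v}" e v] uM that by auto
      next
        case False
        then show ?thesis using cover that by auto
      qed
      then show ?thesis using cross[of e] ME[OF that(1)] by auto
    qed
    let ?MH = "{e \<in> M. e \<subseteq> H}" and ?MK = "{e \<in> M. e \<subseteq> S - H - {v}}"
    have MH: "is_matching E ?MH" and MK: "is_matching E ?MK"
      using M by (auto simp: is_matching_def intro: pairwise_subset)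
    have covered: "\<exists>e\<in>M. x \<in> e \<and> e \<noteq> {u, v}" if "x \<in> S - {u, v} \<or> x = u \<and> \<Union>M \<noteq> S" for x
    proof -
      have "x \<in> \<Union>M" using that cover uv u(1) by auto
      then obtain e where e: "e \<in> M" "x \<in> e" by auto
      have "e \<noteq> {u, v}"
      proof (cases "x = u")
        case True
        then have "v \<notin> \<Union>M" using that cover by auto
        then show ?thesis using e by auto
      qed (use that e in auto)
      then show ?thesis using e by auto
    qed
    have coverK: "\<Union>?MK = S - H - {v}"
    proof (intro equalityI subsetI)
      fix x assume x: "x \<in> S - H - {v}"
      then obtain e where e: "e \<in> M" "x \<in> e" "e \<noteq> {u, v}" using covered[of x] H(2) by auto
      then have "e \<subseteq> S - H - {v}" using side[of e] x by auto
      then show "x \<in> \<Union>?MK" using e by auto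
    qed auto
    \<comment> \<open>Here \<open>u\<close> is missed exactly when its partner is \<open>v\<close>;
      enclosing the union between \<open>H - {u}\<close> and \<open>H\<close> covers both
      situations.\<close>
    have coverH: "\<Union>?MH = H \<or> \<Union>?MH = H - {u}"
    proof -
      have "x \<in> \<Union>?MH" if x: "x \<in> H" "x \<noteq> u" for x
      proof -
        obtain e where e: "e \<in> M" "x \<in> e" "e \<noteq> {u, v}" using covered[of x] H(1) x by auto
        then have "e \<subseteq> H" using side[of e] x by auto
        then show ?thesis using e by auto
      qed
      then have "H - {u} \<subseteq> \<Union>?MH" by blast
      moreover have "\<Union>?MH \<subseteq> H" by blast
      ultimately show ?thesis by blast
    qed
    have less: "card H < card S" "card (S - H) < card S"
      using H(1,2) v fin by (auto intro!: psubset_card_mono)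
    obtain wH where wH: "\<And>e. wH e > 0" "interlaces (sub_mpoly E wH (H - {u})) (sub_mpoly E wH H)"
      using less.hyps[OF less(1) _ H(2) H(3) MH coverH] finite_subset[OF _ fin, of H] H(1) by blast
    obtain wK where wK: "\<And>e. wK e > 0"
      "interlaces (sub_mpoly E wK (S - H - {v})) (sub_mpoly E wK (S - H))"
      using less.hyps[OF less(2) _ _ H(4) MK disjI2[OF coverK]] fin v H(1) by blast
    have "even (card (S - H - {v}))"
      using is_matching_card_Union[OF MK E] unfolding coverK by simp
    then show ?thesis
      using exists_weighting_join[OF fin v H(1,2) u(2) E cross _ wH wK] by blast
  qed
qed

section \<open>Return to simple roots and the original graph\<close>

lemma matching_polys_SRSI:
  assumes "card V \<ge> 2" "v \<in> V"
    and "lead_coeff (matching_poly V E w) = 1" "degree (matching_poly V E w) = card V"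
    and "lead_coeff (matching_poly (V - {v}) (del_vertex_edges E v) w) = 1"
    and "degree (matching_poly (V - {v}) (del_vertex_edges E v) w) = card V - 1"
    and int: "interlaces (matching_poly (V - {v}) (del_vertex_edges E v) w) (matching_poly V E w)"
  shows "SRSI V E w v"
proof -
  obtain l m where lm: "strictly_interlacing (card V - 1) l m"
    and peq: "matching_poly V E w = (\<Prod>i\<in>{1..Suc (card V - 1)}. [:- l i, 1:])"
    and qeq: "matching_poly (V - {v}) (del_vertex_edges E v) w = (\<Prod>i\<in>{1..card V - 1}. [:- m i, 1:])"
    using interlaces_roots[OF assms(3,5) _ assms(6) int] assms by auto
  have n: "Suc (card V - 1) = card V" using assms(1) by simp
  show ?thesis
    unfolding SRSI_def peq qeq n using assms(1,2) lm unfolding strictly_interlacing_def n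
    by (intro conjI exI[of _ l] exI[of _ m] simple_roots_prod) blast+
qed

theorem theorem3p7:
  fixes V :: "'a set" and E :: "'a set set"
  assumes "simple_graph V E"
    and "connected_graph V E"
    and "card V \<ge> 2"
    and "(\<exists>M. perfect_matching V E M) \<or> (\<exists>M. nearly_perfect_matching V E M)"
  shows "\<exists>w v. edge_weighting E w \<and> v \<in> V \<and> SRSI V E w v"
proof -
  have fin: "finite V" and sub: "E \<subseteq> Pow V" and E: "\<And>e. e \<in> E \<Longrightarrow> card e = 2"
    using assms(1) by (auto simp: simple_graph_def)
  obtain M v where v: "v \<in> V" and M: "is_matching E M" "\<Union>M = V \<or> \<Union>M = V - {v}"
    using assms(2,4) unfolding perfect_matching_def nearly_perfect_matching_def connected_graph_def by blast
  \<comment> \<open>All edges lie inside \<open>V\<close>, so restricting paths to \<open>V\<close>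
    changes nothing.\<close>
  have "adjacent_within E V = {(x, y). {x, y} \<in> E}"
    using sub by (auto simp: adjacent_within_def)
  then have conn: "(x, v) \<in> (adjacent_within E V)\<^sup>*" if "x \<in> V" for x
    using assms(2) v that by (simp add: connected_graph_def)
  obtain w where w: "\<And>e. w e > 0" and int: "interlaces (sub_mpoly E w (V - {v})) (sub_mpoly E w V)"
    using exists_interlacing_weighting[OF E fin v conn M] by blast
  have V: "sub_mpoly E w V = matching_poly V E w"
    using sub by (simp add: sub_mpoly_def inf.absorb1)
  have "E \<inter> Pow (V - {v}) = del_vertex_edges E v"
    using sub by (auto simp: del_vertex_edges_def)
  then have Vv: "sub_mpoly E w (V - {v}) = matching_poly (V - {v}) (del_vertex_edges E v) w"
    by (simp add: sub_mpoly_def)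
  have "SRSI V E w v"
    using assms(3) v int sub_mpoly_monic[of V E w] sub_mpoly_monic[of "V - {v}" E w] fin E
    unfolding V Vv by (intro matching_polys_SRSI) auto
  then show ?thesis using w v by (auto simp: edge_weighting_def)
qed

end
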